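(* For every $n\ge 4$, the automorphism group of the cubic graph $\Gamma_{D_n}$ is isomorphic to the dihedral group $D_n$, where $\Gamma_{D_n}$ is the graph with the $4n$ nodes $a_i,b_i,c_i,d_i$ ($i=1,\dots,n$) whose edges are $\{a_i,b_i\}$, $\{a_i,c_i\}$, $\{c_i,d_i\}$, $\{b_i,c_i\}$ for $i=1,\dots,n$, together with $\{a_j,b_{j+1}\}$ and $\{d_j,d_{j+1}\}$ for $j=1,\dots,n-1$, and $\{a_n,b_1\}$ and $\{d_1,d_n\}$.
   Context: $D_n$ denotes the dihedral group of order $2n$. The automorphism group of a graph is the group of permutations of its nodes preserving adjacency. (In the paper the edge set of $\Gamma_{D_n}$ is encoded as the set of monomials of a quadratic form $Q_{D_n}$ in indeterminates $a_i,b_i,c_i,d_i$.) *)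

theory Defs
  imports "HOL-Algebra.Bij" "HOL-Algebra.Coset"
begin

text \<open>A finite simple graph is given by its node set \<open>V\<close> and its set \<open>E\<close> of edges, each edge being
  an unordered pair \<open>{u, v}\<close> of distinct nodes.\<close>

definition simple_graph :: "'a set \<Rightarrow> 'a set set \<Rightarrow> bool" where
  "simple_graph V E \<longleftrightarrow> finite V \<and> (\<forall>e\<in>E. e \<subseteq> V \<and> card e = 2)"

definition cubic_graph :: "'a set \<Rightarrow> 'a set set \<Rightarrow> bool" where
  "cubic_graph V E \<longleftrightarrow> simple_graph V E \<and> (\<forall>v\<in>V. card {u \<in> V. {v, u} \<in> E} = 3)"

definition graph_auts :: "'a set \<Rightarrow> 'a set set \<Rightarrow> ('a \<Rightarrow> 'a) set" where
  "graph_auts V E = {f \<in> Bij V. \<forall>u\<in>V. \<forall>v\<in>V. {f u, f v} \<in> E \<longleftrightarrow> {u, v} \<in> E}"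

definition graph_aut_group :: "'a set \<Rightarrow> 'a set set \<Rightarrow> ('a \<Rightarrow> 'a) monoid" where
  "graph_aut_group V E = BijGroup V \<lparr>carrier := graph_auts V E\<rparr>"

lemma subgroup_graph_auts: "subgroup (graph_auts V E) (BijGroup V)"
proof (rule group.subgroupI[OF group_BijGroup])
  show "graph_auts V E \<subseteq> carrier (BijGroup V)"
    by (auto simp: graph_auts_def BijGroup_def)
  show "graph_auts V E \<noteq> {}"
    using id_Bij[of V] by (force simp: graph_auts_def)
next
  fix f assume f: "f \<in> graph_auts V E"
  then have fB: "f \<in> Bij V" by (simp add: graph_auts_def)
  then have bij: "bij_betw f V V" by (simp add: Bij_def)
  define g where "g = (\<lambda>x\<in>V. inv_into V f x)"
  have gB: "g \<in> Bij V" unfolding g_def by (rule restrict_inv_into_Bij[OF fB])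
  have "g \<otimes>\<^bsub>BijGroup V\<^esub> f = \<one>\<^bsub>BijGroup V\<^esub>"
    using Bij_compose_restrict_eq[OF fB] fB gB by (simp add: BijGroup_def g_def)
  then have inv: "inv\<^bsub>BijGroup V\<^esub> f = g"
    using group.inv_equality[OF group_BijGroup[of V], of g f] fB gB by (simp add: BijGroup_def)
  have g: "g x \<in> V" "f (g x) = x" if "x \<in> V" for x
    using that bij by (auto simp: g_def bij_betw_def inv_into_into f_inv_into_f)
  have "{g u, g v} \<in> E \<longleftrightarrow> {u, v} \<in> E" if "u \<in> V" "v \<in> V" for u v
  proof -
    have "{f (g u), f (g v)} \<in> E \<longleftrightarrow> {g u, g v} \<in> E"
      using f g(1)[OF that(1)] g(1)[OF that(2)] unfolding graph_auts_def by blast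
    then show ?thesis using that g(2) by simp
  qed
  then show "inv\<^bsub>BijGroup V\<^esub> f \<in> graph_auts V E"
    using gB inv by (simp add: graph_auts_def)
next
  fix f g assume fg: "f \<in> graph_auts V E" "g \<in> graph_auts V E"
  then have B: "f \<in> Bij V" "g \<in> Bij V" by (auto simp: graph_auts_def)
  then have gV: "g x \<in> V" if "x \<in> V" for x
    using that Bij_imp_funcset by blast
  show "f \<otimes>\<^bsub>BijGroup V\<^esub> g \<in> graph_auts V E"
    using fg B gV compose_Bij[OF B]
    by (simp add: graph_auts_def BijGroup_def compose_eq)
qed

lemma group_graph_aut_group: "group (graph_aut_group V E)"
  unfolding graph_aut_group_def
  by (rule group.subgroup_imp_group[OF group_BijGroup subgroup_graph_auts])

text \<open>The dihedral group of order \<open>2n\<close> as the semidirect product of \<open>\<int>/n\<int>\<close> (residues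
  \<open>0, \<dots>, n - 1\<close>) with a group of order two acting by inversion: \<open>(k, False)\<close> is the rotation
  \<open>r\<^sup>k\<close> and \<open>(k, True)\<close> is the reflection \<open>r\<^sup>k s\<close>, where \<open>s r = r\<^sup>-\<^sup>1 s\<close>.\<close>

definition dihedral_group :: "nat \<Rightarrow> (int \<times> bool) monoid" where
  "dihedral_group n =
    \<lparr>carrier = {0..<int n} \<times> UNIV,
     mult = (\<lambda>(k, s) (l, t). ((if s then k - l else k + l) mod int n, s \<noteq> t)),
     one = (0, False)\<rparr>"

lemma group_dihedral_group:
  assumes "n > 0"
  shows "group (dihedral_group n)"
proof (rule groupI)
  fix x assume x: "x \<in> carrier (dihedral_group n)"
  obtain k s where [simp]: "x = (k, s)" by (cases x)
  show "\<exists>y\<in>carrier (dihedral_group n). y \<otimes>\<^bsub>dihedral_group n\<^esub> x = \<one>\<^bsub>dihedral_group n\<^esub>"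
    using x assms
    by (intro bexI[of _ "(if s then k else (- k) mod int n, s)"])
       (auto simp: dihedral_group_def mod_simps)
qed (use assms in \<open>auto simp: dihedral_group_def mod_simps algebra_simps\<close>)

lemma order_dihedral_group: "order (dihedral_group n) = 2 * n"
  by (simp add: dihedral_group_def order_def card_cartesian_product)

datatype gamma_node = A nat | B nat | C nat | D nat

definition gamma_nodes :: "nat \<Rightarrow> gamma_node set" where
  "gamma_nodes n = (\<Union>i\<in>{1..n}. {A i, B i, C i, D i})"

definition gamma_edges :: "nat \<Rightarrow> gamma_node set set" where
  "gamma_edges n =
     (\<Union>i\<in>{1..n}. {{A i, B i}, {A i, C i}, {C i, D i}, {B i, C i}})
     \<union> (\<Union>j\<in>{1..n - 1}. {{A j, B (j + 1)}, {D j, D (j + 1)}})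
     \<union> {{A n, B 1}, {D 1, D n}}"

lemma card_gamma_nodes: "card (gamma_nodes n) = 4 * n"
proof -
  have "card (gamma_nodes n) = (\<Sum>i\<in>{1..n}. card {A i, B i, C i, D i})"
    unfolding gamma_nodes_def by (rule card_UN_disjoint) auto
  then show ?thesis by simp
qed

lemma gamma_edges_iff:
  "{A i, A j} \<notin> gamma_edges n" "{B i, B j} \<notin> gamma_edges n" "{C i, C j} \<notin> gamma_edges n"
  "{A i, D j} \<notin> gamma_edges n" "{B i, D j} \<notin> gamma_edges n"
  "{A i, C j} \<in> gamma_edges n \<longleftrightarrow> i = j \<and> i \<in> {1..n}"
  "{B i, C j} \<in> gamma_edges n \<longleftrightarrow> i = j \<and> i \<in> {1..n}"
  "{C i, D j} \<in> gamma_edges n \<longleftrightarrow> i = j \<and> i \<in> {1..n}"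
  "{A i, B j} \<in> gamma_edges n \<longleftrightarrow>
     i = j \<and> i \<in> {1..n} \<or> i \<in> {1..n - 1} \<and> j = i + 1 \<or> i = n \<and> j = 1"
  "{D i, D j} \<in> gamma_edges n \<longleftrightarrow>
     i \<in> {1..n - 1} \<and> j = i + 1 \<or> j \<in> {1..n - 1} \<and> i = j + 1
     \<or> i = 1 \<and> j = n \<or> i = n \<and> j = 1"
  unfolding gamma_edges_def by (auto simp: doubleton_eq_iff)

lemma gamma_nodes_iff:
  "A i \<in> gamma_nodes n \<longleftrightarrow> i \<in> {1..n}" "B i \<in> gamma_nodes n \<longleftrightarrow> i \<in> {1..n}"
  "C i \<in> gamma_nodes n \<longleftrightarrow> i \<in> {1..n}" "D i \<in> gamma_nodes n \<longleftrightarrow> i \<in> {1..n}"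
  by (auto simp: gamma_nodes_def)

lemma cubic_gamma:
  assumes "n \<ge> 3"
  shows "cubic_graph (gamma_nodes n) (gamma_edges n)"
  unfolding cubic_graph_def
proof (intro conjI ballI)
  show "simple_graph (gamma_nodes n) (gamma_edges n)"
    using assms unfolding simple_graph_def gamma_nodes_def gamma_edges_def
    by (auto simp: card_insert_if)
next
  fix v assume v: "v \<in> gamma_nodes n"
  then obtain i where i: "1 \<le> i" "i \<le> n" "v \<in> {A i, B i, C i, D i}"
    by (auto simp: gamma_nodes_def)
  define s p where "s = (if i = n then 1 else i + 1)" and "p = (if i = 1 then n else i - 1)"
  have ne: "s \<noteq> i" "p \<noteq> i" "s \<noteq> p"
    using i assms by (auto simp: s_def p_def)
  have sp: "s \<in> {1..n}" "p \<in> {1..n}"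
    using i assms by (auto simp: s_def p_def)
  have AB: "{A i, B j} \<in> gamma_edges n \<longleftrightarrow> j = i \<or> j = s" for j
    using i unfolding gamma_edges_iff s_def by auto
  have BA: "{B i, A j} \<in> gamma_edges n \<longleftrightarrow> j = i \<or> j = p" for j
    using i unfolding insert_commute[of "B i"] gamma_edges_iff p_def by auto
  have DD: "{D i, D j} \<in> gamma_edges n \<longleftrightarrow> j = s \<or> j = p" for j
    using i assms unfolding gamma_edges_iff s_def p_def by auto
  have swap: "{C i, A j} = {A j, C i}" "{C i, B j} = {B j, C i}" "{D i, A j} = {A j, D i}"
    "{D i, B j} = {B j, D i}" "{D i, C j} = {C j, D i}" for j
    by auto
  note adj = gamma_nodes_iff AB BA DD swap gamma_edges_iff(1-8)
  have n1: "{u \<in> gamma_nodes n. {A i, u} \<in> gamma_edges n} = {B i, C i, B s}"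
  proof (rule Set.set_eqI)
    fix u show "u \<in> {u \<in> gamma_nodes n. {A i, u} \<in> gamma_edges n} \<longleftrightarrow> u \<in> {B i, C i, B s}"
      using i(1,2) sp by (cases u) (auto simp: adj)
  qed
  have n2: "{u \<in> gamma_nodes n. {B i, u} \<in> gamma_edges n} = {A i, C i, A p}"
  proof (rule Set.set_eqI)
    fix u show "u \<in> {u \<in> gamma_nodes n. {B i, u} \<in> gamma_edges n} \<longleftrightarrow> u \<in> {A i, C i, A p}"
      using i(1,2) sp by (cases u) (auto simp: adj)
  qed
  have n3: "{u \<in> gamma_nodes n. {C i, u} \<in> gamma_edges n} = {A i, B i, D i}"
  proof (rule Set.set_eqI)
    fix u show "u \<in> {u \<in> gamma_nodes n. {C i, u} \<in> gamma_edges n} \<longleftrightarrow> u \<in> {A i, B i, D i}"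
      using i(1,2) sp by (cases u) (auto simp: adj)
  qed
  have n4: "{u \<in> gamma_nodes n. {D i, u} \<in> gamma_edges n} = {C i, D s, D p}"
  proof (rule Set.set_eqI)
    fix u show "u \<in> {u \<in> gamma_nodes n. {D i, u} \<in> gamma_edges n} \<longleftrightarrow> u \<in> {C i, D s, D p}"
      using i(1,2) sp by (cases u) (auto simp: adj)
  qed
  show "card {u \<in> gamma_nodes n. {v, u} \<in> gamma_edges n} = 3"
    using i(3) ne ne[symmetric] by (elim insertE emptyE) (simp_all add: n1 n2 n3 n4)
qed

end

theory Submission
  imports Defs
begin

text \<open>
  The nodes \<open>A i\<close>, \<open>B i\<close>, \<open>C i\<close> form a triangle, the triangles are strung into a ring by the edges
  from \<open>A i\<close> to \<open>B (i + 1)\<close>, and each triangle is attached through \<open>C i\<close> to a node \<open>D i\<close> of an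
  \<open>n\<close>-cycle. Reading the indices as residues modulo \<open>n\<close>, the index shift \<open>i \<mapsto> i + k\<close> is an
  automorphism, and so is the reversal \<open>i \<mapsto> k - i\<close> provided that it interchanges the letters \<open>A\<close>
  and \<open>B\<close>, because it turns the ring round. This defines an action of the dihedral group, which is
  faithful since distinct elements send \<open>A 1\<close> to distinct nodes (\<open>inj_on_dihedral_aut\<close>).

  There are no other automorphisms. For \<open>n \<ge> 4\<close> the cycle of the \<open>D i\<close> is not itself a triangle,
  so the \<open>D i\<close> are exactly the nodes that lie on no triangle, and every automorphism permutes them.
  Hence the \<open>C i\<close>, their neighbours on triangles, are permuted too, and \<open>A 1\<close> can only go to some
  \<open>A j\<close> or \<open>B j\<close>; each of these \<open>2 n\<close> nodes is the image of \<open>A 1\<close> under a dihedral element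
  (\<open>dihedral_aut_transitive\<close>). It remains to see that an automorphism fixing \<open>A 1\<close> is trivial
  (\<open>gamma_aut_fixing_A1\<close>): it fixes the triangle of \<open>A 1\<close> pointwise, therefore also the third
  neighbour \<open>B 2\<close> of \<open>A 1\<close>, and so on round the ring. So the action is regular on the \<open>A i\<close> and
  \<open>B i\<close>, and the dihedral group is the full automorphism group.
\<close>

section \<open>Automorphisms and triangles\<close>

lemma graph_autsD:
  assumes "f \<in> graph_auts V E"
  shows "bij_betw f V V" "f \<in> extensional V"
    and "\<And>u. u \<in> V \<Longrightarrow> f u \<in> V"
    and "\<And>u v. u \<in> V \<Longrightarrow> v \<in> V \<Longrightarrow> {f u, f v} \<in> E \<longleftrightarrow> {u, v} \<in> E"
    and "\<And>u v. u \<in> V \<Longrightarrow> v \<in> V \<Longrightarrow> f u = f v \<longleftrightarrow> u = v"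
proof -
  show bij: "bij_betw f V V" and "f \<in> extensional V"
    using assms by (simp_all add: graph_auts_def Bij_def)
  show "f u \<in> V" if "u \<in> V" for u
    using bij that by (rule bij_betwE[rule_format])
  show "{f u, f v} \<in> E \<longleftrightarrow> {u, v} \<in> E" if "u \<in> V" "v \<in> V" for u v
    using assms that by (simp add: graph_auts_def)
  show "f u = f v \<longleftrightarrow> u = v" if "u \<in> V" "v \<in> V" for u v
    using that by (rule inj_on_eq_iff[OF bij_betw_imp_inj_on[OF bij]])
qed

lemma graph_auts_surj:
  assumes "f \<in> graph_auts V E" "v \<in> V"
  obtains u where "u \<in> V" "f u = v"
proof -
  have "v \<in> f ` V"
    using bij_betw_imp_surj_on[OF graph_autsD(1)[OF assms(1)]] assms(2) by (rule ssubst)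
  then show thesis
    by (auto intro: that)
qed

definition in_triangle :: "'a set \<Rightarrow> 'a set set \<Rightarrow> 'a \<Rightarrow> bool" where
  "in_triangle V E v \<longleftrightarrow> (\<exists>u\<in>V. \<exists>w\<in>V. {v, u} \<in> E \<and> {v, w} \<in> E \<and> {u, w} \<in> E)"

lemma in_triangle_aut:
  assumes f: "f \<in> graph_auts V E" and v: "v \<in> V"
  shows "in_triangle V E (f v) \<longleftrightarrow> in_triangle V E v"
proof
  assume "in_triangle V E v"
  then show "in_triangle V E (f v)"
    using graph_autsD(3,4)[OF f] v unfolding in_triangle_def by meson
next
  assume "in_triangle V E (f v)"
  then obtain u w where "u \<in> V" "w \<in> V" "{f v, u} \<in> E" "{f v, w} \<in> E" "{u, w} \<in> E"
    unfolding in_triangle_def by blast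
  moreover obtain u' where "u' \<in> V" "f u' = u"
    using graph_auts_surj[OF f \<open>u \<in> V\<close>] .
  moreover obtain w' where "w' \<in> V" "f w' = w"
    using graph_auts_surj[OF f \<open>w \<in> V\<close>] .
  ultimately show "in_triangle V E v"
    using graph_autsD(4)[OF f] v unfolding in_triangle_def by blast
qed

section \<open>Indices as residues\<close>

text \<open>The representative of a residue class modulo \<open>n\<close> in the index range \<open>{1..n}\<close>, rather than in
  \<open>{0..<n}\<close>.\<close>

definition wrap :: "nat \<Rightarrow> int \<Rightarrow> nat" where
  "wrap n k = nat ((k - 1) mod int n) + 1"

lemma wrap_range:
  assumes "n > 0" shows "wrap n k \<in> {1..n}"
proof -
  have "nat ((k - 1) mod int n) < n"
    using assms by (simp add: nat_less_iff)
  then show ?thesis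
    unfolding wrap_def by simp
qed

lemma wrap_id: "i \<in> {1..n} \<Longrightarrow> wrap n (int i) = i"
  unfolding wrap_def by (auto simp: nat_diff_distrib)

lemma wrap_eq_iff:
  assumes "n > 0" shows "wrap n k = wrap n l \<longleftrightarrow> int n dvd k - l"
proof -
  have "wrap n k = wrap n l \<longleftrightarrow> (k - 1) mod int n = (l - 1) mod int n"
    using assms by (simp add: wrap_def eq_nat_nat_iff)
  then show ?thesis
    by (simp add: mod_eq_dvd_iff)
qed

lemma int_wrap_cong:
  assumes "n > 0" shows "int n dvd int (wrap n k) - k"
  using wrap_eq_iff[OF assms, of "int (wrap n k)" k] wrap_id[OF wrap_range[OF assms, of k]]
  by blast

lemma wrap_eq_nat_iff:
  assumes "i \<in> {1..n}" shows "wrap n k = i \<longleftrightarrow> int n dvd k - int i"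
  using wrap_eq_iff[of n k "int i"] wrap_id[OF assms] assms
  unfolding atLeastAtMost_iff by linarith

lemma dvd_index_succ_iff:
  assumes "i \<in> {1..n}" "j \<in> {1..n}"
  shows "int n dvd int j - int i - 1 \<longleftrightarrow> j = (if i = n then 1 else i + 1)"
proof -
  have "wrap n (int i + 1) = (if i = n then 1 else i + 1)"
    using assms by (auto simp: wrap_def)
  then show ?thesis
    using wrap_eq_nat_iff[OF assms(2), of "int i + 1"]
      dvd_diff_commute[of "int n" "int j" "int i + 1"]
    by (auto simp: algebra_simps)
qed

lemma edge_A_B_iff:
  assumes "i \<in> {1..n}" "j \<in> {1..n}"
  shows "{A i, B j} \<in> gamma_edges n \<longleftrightarrow> int n dvd int j - int i \<or> int n dvd int j - int i - 1"
proof -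
  have "int n dvd int j - int i \<longleftrightarrow> j = i"
    using wrap_eq_nat_iff[OF assms(1), of "int j"] wrap_id[OF assms(2)] by simp
  then show ?thesis
    unfolding dvd_index_succ_iff[OF assms] using assms by (auto simp: gamma_edges_iff)
qed

lemma edge_D_D_iff:
  assumes "i \<in> {1..n}" "j \<in> {1..n}"
  shows "{D i, D j} \<in> gamma_edges n \<longleftrightarrow>
    int n dvd int j - int i - 1 \<or> int n dvd int i - int j - 1"
  unfolding dvd_index_succ_iff[OF assms] dvd_index_succ_iff[OF assms(2,1)]
  using assms by (auto simp: gamma_edges_iff)

section \<open>The dihedral action\<close>

definition dihedral_index :: "nat \<Rightarrow> int \<times> bool \<Rightarrow> nat \<Rightarrow> nat" where
  "dihedral_index n x i = wrap n (if snd x then fst x - int i else fst x + int i)"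

text \<open>A reversal of the ring has to interchange \<open>A\<close> and \<open>B\<close>: the edge from \<open>A i\<close> to \<open>B (i + 1)\<close>
  must go to an edge between the triangles \<open>k - i\<close> and \<open>k - i - 1\<close>, and this one ends in
  \<open>B (k - i)\<close>.\<close>

fun dihedral_node :: "nat \<Rightarrow> int \<times> bool \<Rightarrow> gamma_node \<Rightarrow> gamma_node" where
  "dihedral_node n x (A i) = (if snd x then B else A) (dihedral_index n x i)"
| "dihedral_node n x (B i) = (if snd x then A else B) (dihedral_index n x i)"
| "dihedral_node n x (C i) = C (dihedral_index n x i)"
| "dihedral_node n x (D i) = D (dihedral_index n x i)"

definition dihedral_aut :: "nat \<Rightarrow> int \<times> bool \<Rightarrow> gamma_node \<Rightarrow> gamma_node" where
  "dihedral_aut n x = restrict (dihedral_node n x) (gamma_nodes n)"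

lemma dihedral_index_range: "n > 0 \<Longrightarrow> dihedral_index n x i \<in> {1..n}"
  unfolding dihedral_index_def by (rule wrap_range)

lemma dihedral_node_closed: "n > 0 \<Longrightarrow> dihedral_node n x v \<in> gamma_nodes n"
  using dihedral_index_range[of n x] by (cases v) (auto simp: gamma_nodes_iff)

lemma dihedral_index_one: "i \<in> {1..n} \<Longrightarrow> dihedral_index n (\<one>\<^bsub>dihedral_group n\<^esub>) i = i"
  by (simp add: dihedral_index_def dihedral_group_def wrap_id)

lemma dihedral_index_mult:
  assumes "n > 0"
  shows "dihedral_index n (x \<otimes>\<^bsub>dihedral_group n\<^esub> y) i = dihedral_index n x (dihedral_index n y i)"
proof -
  obtain k s l t where [simp]: "x = (k, s)" "y = (l, t)" by (cases x, cases y)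
  define m where "m = (if t then l - int i else l + int i)"
  obtain p where p: "int (wrap n m) = m + int n * p"
    using int_wrap_cong[OF assms, of m] by (auto simp: dvd_def algebra_simps)
  have "int n dvd (if s then k - l else k + l) mod int n - (if s then k - l else k + l)"
    by (rule mod_eq_dvd_iff[THEN iffD1]) simp
  then obtain q where
    q: "(if s then k - l else k + l) mod int n = (if s then k - l else k + l) + int n * q"
    unfolding dvd_def by (metis diff_eq_eq add.commute)
  have "int n dvd (if s \<noteq> t then (if s then k - l else k + l) mod int n - int i
          else (if s then k - l else k + l) mod int n + int i)
        - (if s then k - int (wrap n m) else k + int (wrap n m))"
    unfolding p q by (cases s; cases t) (auto simp: m_def algebra_simps)
  then show ?thesis
    using assms
    by (cases s; cases t) (simp_all add: dihedral_index_def dihedral_group_def wrap_eq_iff m_def)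
qed

lemma dihedral_node_one:
  "v \<in> gamma_nodes n \<Longrightarrow> dihedral_node n (\<one>\<^bsub>dihedral_group n\<^esub>) v = v"
  using dihedral_index_one[of _ n]
  by (cases v) (auto simp: gamma_nodes_iff, auto simp: dihedral_group_def)

lemma dihedral_node_mult:
  assumes "n > 0"
  shows "dihedral_node n (x \<otimes>\<^bsub>dihedral_group n\<^esub> y) v = dihedral_node n x (dihedral_node n y v)"
proof -
  have "snd (x \<otimes>\<^bsub>dihedral_group n\<^esub> y) \<longleftrightarrow> snd x \<noteq> snd y"
    by (cases x, cases y) (simp add: dihedral_group_def)
  then show ?thesis
    by (cases v) (auto simp: dihedral_index_mult[OF assms])
qed

text \<open>Indices enter the adjacency of nodes only through their differences modulo \<open>n\<close>. A shift keeps
  these, a reversal negates them.\<close>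

lemma dihedral_index_diff:
  assumes "n > 0"
  shows "int n dvd int (dihedral_index n x j) - int (dihedral_index n x i) - c \<longleftrightarrow>
    int n dvd (if snd x then int i - int j else int j - int i) - c"
proof -
  define a b where "a = (if snd x then fst x - int j else fst x + int j)"
    and "b = (if snd x then fst x - int i else fst x + int i)"
  have shift: "int n dvd (int (wrap n a) - a) - (int (wrap n b) - b)"
    by (intro dvd_diff int_wrap_cong[OF assms])
  have eq: "int (wrap n a) - int (wrap n b) - c
      = ((int (wrap n a) - a) - (int (wrap n b) - b)) + (a - b - c)"
    by simp
  have "int n dvd int (wrap n a) - int (wrap n b) - c \<longleftrightarrow> int n dvd a - b - c"
    unfolding eq by (rule dvd_add_right_iff[OF shift])
  then show ?thesis
    by (auto simp: dihedral_index_def a_def b_def)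
qed

lemma dihedral_index_eq_iff:
  assumes "i \<in> {1..n}" "j \<in> {1..n}"
  shows "dihedral_index n x i = dihedral_index n x j \<longleftrightarrow> i = j"
proof -
  have n: "n > 0" using assms by simp
  have "dihedral_index n x i = dihedral_index n x j \<longleftrightarrow> wrap n (int i) = wrap n (int j)"
    unfolding dihedral_index_def wrap_eq_iff[OF n]
    using dvd_diff_commute[of "int n" "int i" "int j"] by auto
  then show ?thesis
    unfolding wrap_id[OF assms(1)] wrap_id[OF assms(2)] .
qed

lemma dihedral_node_edge:
  assumes "n > 0" and u: "u \<in> gamma_nodes n" and v: "v \<in> gamma_nodes n"
  shows "{dihedral_node n x u, dihedral_node n x v} \<in> gamma_edges n \<longleftrightarrow> {u, v} \<in> gamma_edges n"
proof -
  note range = dihedral_index_range[OF \<open>n > 0\<close>]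
  note diff0 = dihedral_index_diff[OF \<open>n > 0\<close>, where c = 0, simplified]
  have swap: "{B i, A j} = {A j, B i}" "{C i, A j} = {A j, C i}" "{C i, B j} = {B j, C i}"
    "{D i, A j} = {A j, D i}" "{D i, B j} = {B j, D i}" "{D i, C j} = {C j, D i}" for i j
    by auto
  show ?thesis
    using u v
    by (cases u; cases v)
      (auto simp: gamma_nodes_iff swap gamma_edges_iff(1-8) edge_A_B_iff edge_D_D_iff range
        dihedral_index_eq_iff diff0 dihedral_index_diff[OF \<open>n > 0\<close>]
        simp del: atLeastAtMost_iff One_nat_def)
qed

lemma dihedral_aut_in_auts:
  assumes n: "n > 0" and x: "x \<in> carrier (dihedral_group n)"
  shows "dihedral_aut n x \<in> graph_auts (gamma_nodes n) (gamma_edges n)"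
proof -
  interpret group "dihedral_group n" by (rule group_dihedral_group[OF n])
  let ?V = "gamma_nodes n" and ?y = "inv\<^bsub>dihedral_group n\<^esub> x"
  have "bij_betw (dihedral_node n x) ?V ?V"
    using x by (intro bij_betw_byWitness[where f' = "dihedral_node n ?y"])
      (auto simp: dihedral_node_closed n dihedral_node_one simp flip: dihedral_node_mult)
  then show ?thesis
    by (auto simp: graph_auts_def Bij_def dihedral_aut_def dihedral_node_edge n)
qed

lemma dihedral_aut_hom:
  assumes n: "n > 0"
  shows "dihedral_aut n \<in> hom (dihedral_group n) (graph_aut_group (gamma_nodes n) (gamma_edges n))"
proof (rule homI)
  fix x y assume xy: "x \<in> carrier (dihedral_group n)" "y \<in> carrier (dihedral_group n)"
  then have "dihedral_aut n x \<in> Bij (gamma_nodes n)" "dihedral_aut n y \<in> Bij (gamma_nodes n)"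
    using dihedral_aut_in_auts[OF n] by (auto simp: graph_auts_def)
  then show "dihedral_aut n (x \<otimes>\<^bsub>dihedral_group n\<^esub> y) =
      dihedral_aut n x \<otimes>\<^bsub>graph_aut_group (gamma_nodes n) (gamma_edges n)\<^esub> dihedral_aut n y"
    by (auto simp: graph_aut_group_def BijGroup_def dihedral_aut_def compose_def restrict_def
        dihedral_node_mult n dihedral_node_closed)
qed (simp add: graph_aut_group_def dihedral_aut_in_auts n)

lemma inj_on_dihedral_aut:
  assumes n: "n > 0"
  shows "inj_on (dihedral_aut n) (carrier (dihedral_group n))"
proof (rule inj_onI)
  fix x y assume xy: "x \<in> carrier (dihedral_group n)" "y \<in> carrier (dihedral_group n)"
    and eq: "dihedral_aut n x = dihedral_aut n y"
  have "A 1 \<in> gamma_nodes n"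
    using n by (simp add: gamma_nodes_iff)
  then have "dihedral_node n x (A 1) = dihedral_node n y (A 1)"
    using fun_cong[OF eq, of "A 1"] by (simp add: dihedral_aut_def)
  then have s: "snd x = snd y" and "dihedral_index n x 1 = dihedral_index n y 1"
    by (auto split: if_splits)
  then have "int n dvd fst x - fst y"
    unfolding dihedral_index_def wrap_eq_iff[OF n] by (auto split: if_splits)
  then have "fst x mod int n = fst y mod int n"
    by (simp add: mod_eq_dvd_iff)
  then have "fst x = fst y"
    using xy by (auto simp: dihedral_group_def)
  with s show "x = y"
    by (simp add: prod_eq_iff)
qed

lemma dihedral_aut_transitive:
  assumes "v = A j \<or> v = B j" "j \<in> {1..n}"
  obtains x where "x \<in> carrier (dihedral_group n)" "dihedral_aut n x (A 1) = v"
proof -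
  have n: "n > 0" using assms by simp
  \<comment> \<open>The dihedral element must take the index \<open>1\<close> to \<open>j\<close>, by \<open>1 \<mapsto> (j - 1) + 1\<close> or by
    \<open>1 \<mapsto> (j + 1) - 1\<close>.\<close>
  define s where "s \<longleftrightarrow> v = B j"
  define k where "k = (if s then int j + 1 else int j - 1)"
  define x where "x = (k mod int n, s)"
  have "(if s then k mod int n - 1 else k mod int n + 1) - int j = k mod int n - k"
    by (simp add: k_def)
  moreover have "int n dvd k mod int n - k"
    by (rule mod_eq_dvd_iff[THEN iffD1]) simp
  ultimately have "int n dvd (if s then k mod int n - 1 else k mod int n + 1) - int j"
    by (rule ssubst)
  then have "dihedral_index n x 1 = j"
    unfolding dihedral_index_def wrap_eq_nat_iff[OF assms(2)] by (cases s) (simp_all add: x_def)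
  then have "dihedral_aut n x (A 1) = v"
    using assms n by (auto simp: dihedral_aut_def gamma_nodes_iff s_def x_def)
  moreover have "x \<in> carrier (dihedral_group n)"
    using n by (simp add: dihedral_group_def x_def)
  ultimately show thesis by (rule that[rotated])
qed

section \<open>Rigidity\<close>

text \<open>Here \<open>n \<ge> 4\<close> matters. A triangle through \<open>D i\<close> would have to consist of \<open>D\<close> nodes, and going
  once round it would change the index by \<open>\<plusminus>1 \<plusminus> 1 \<plusminus> 1\<close>, so that \<open>n\<close> would divide \<open>1\<close> or \<open>3\<close>.\<close>

lemma in_triangle_gamma_iff:
  assumes n: "n \<ge> 4" and v: "v \<in> gamma_nodes n"
  shows "in_triangle (gamma_nodes n) (gamma_edges n) v \<longleftrightarrow> v \<notin> range D"
proof (cases v)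
  case (D i)
  have False if u: "u \<in> gamma_nodes n" "w \<in> gamma_nodes n" and
    e: "{D i, u} \<in> gamma_edges n" "{D i, w} \<in> gamma_edges n" "{u, w} \<in> gamma_edges n" for u w
  proof -
    have CD: "{C j, D l} = {D l, C j}" for j l
      by auto
    have nb: "x = C l \<or> (\<exists>j. x = D j)" if "{D l, x} \<in> gamma_edges n" for l x
      using that by (cases x) (auto simp: insert_commute[of "D l"] gamma_edges_iff(4,5,8))
    have irrefl: "{D l, D l} \<notin> gamma_edges n" for l
      using n gamma_edges_iff(10)[of l l n] by auto
    have CDi: "l = i" if "{C i, D l} \<in> gamma_edges n" for l
      using that by (simp add: gamma_edges_iff)
    from nb[OF e(1)] obtain j where j: "u = D j"
    proof
      assume u: "u = C i"
      with e(3) gamma_edges_iff(3)[of i i n] nb[OF e(2)] obtain l where "w = D l" by blast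
      then show thesis
        using CDi[of l] e(2,3) u irrefl by blast
    qed blast
    from nb[OF e(2)] obtain l where l: "w = D l"
    proof
      assume "w = C i"
      then show thesis
        using CDi[of j] e(1,3) j CD irrefl by metis
    qed blast
    have ij: "i \<in> {1..n}" "j \<in> {1..n}" "l \<in> {1..n}"
      using v u D j l by (simp_all add: gamma_nodes_iff)
    have step: "\<exists>s. \<bar>s\<bar> = 1 \<and> int n dvd int b - int a - s"
      if "{D a, D b} \<in> gamma_edges n" "a \<in> {1..n}" "b \<in> {1..n}" for a b
    proof -
      from that consider "int n dvd int b - int a - 1" | "int n dvd int a - int b - 1"
        by (auto simp: edge_D_D_iff)
      then show ?thesis
      proof cases
        case 2
        then have "int n dvd int b - int a - (- 1)"
          using dvd_minus_iff[of "int n" "int a - int b - 1"] by (simp add: algebra_simps)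
        then show ?thesis by (metis abs_minus abs_1)
      qed (use abs_1 in blast)
    qed
    obtain p where p: "\<bar>p\<bar> = 1" "int n dvd int j - int i - p" using step e(1) j l ij by blast
    obtain q where q: "\<bar>q\<bar> = 1" "int n dvd int l - int j - q" using step e(3) j l ij by blast
    obtain r where r: "\<bar>r\<bar> = 1" "int n dvd int l - int i - r" using step e(2) j l ij by blast
    have "int n dvd (int l - int i - r) - ((int j - int i - p) + (int l - int j - q))"
      by (intro dvd_diff dvd_add p q r)
    then have "int n dvd p + q - r"
      by (simp add: algebra_simps)
    moreover have "p = 1 \<or> p = -1" "q = 1 \<or> q = -1" "r = 1 \<or> r = -1"
      using p(1) q(1) r(1) by linarith+
    then have "p + q - r \<noteq> 0" "\<bar>p + q - r\<bar> < int n"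
      using n by auto
    ultimately show False
      using dvd_imp_le_int[of "p + q - r" "int n"] by auto
  qed
  then show ?thesis
    using D unfolding in_triangle_def by blast
next
  case (A i)
  have "{A i, B i} \<in> gamma_edges n" "{A i, C i} \<in> gamma_edges n" "{B i, C i} \<in> gamma_edges n"
    "B i \<in> gamma_nodes n" "C i \<in> gamma_nodes n"
    using v A by (auto simp: gamma_edges_iff gamma_nodes_iff)
  then show ?thesis
    unfolding in_triangle_def A by blast
next
  case (B i)
  have "{B i, A i} \<in> gamma_edges n" "{B i, C i} \<in> gamma_edges n" "{A i, C i} \<in> gamma_edges n"
    "A i \<in> gamma_nodes n" "C i \<in> gamma_nodes n"
    using v B by (auto simp: insert_commute[of "B i" "A i"] gamma_edges_iff gamma_nodes_iff)
  then show ?thesis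
    unfolding in_triangle_def B by blast
next
  case (C i)
  have "{C i, A i} \<in> gamma_edges n" "{C i, B i} \<in> gamma_edges n" "{A i, B i} \<in> gamma_edges n"
    "A i \<in> gamma_nodes n" "B i \<in> gamma_nodes n"
    using v C by (auto simp: insert_commute[of "C i"] gamma_edges_iff gamma_nodes_iff)
  then show ?thesis
    unfolding in_triangle_def C by blast
qed

lemma gamma_aut_D_iff:
  assumes "n \<ge> 4" "f \<in> graph_auts (gamma_nodes n) (gamma_edges n)" "v \<in> gamma_nodes n"
  shows "f v \<in> range D \<longleftrightarrow> v \<in> range D"
  using in_triangle_aut[OF assms(2,3)] in_triangle_gamma_iff[OF assms(1)]
    graph_autsD(3)[OF assms(2,3)] assms(3) by blast

lemma gamma_aut_A1:
  assumes n: "n \<ge> 4" and f: "f \<in> graph_auts (gamma_nodes n) (gamma_edges n)"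
  obtains j where "f (A 1) = A j \<or> f (A 1) = B j" "j \<in> {1..n}"
proof -
  have A1: "A 1 \<in> gamma_nodes n"
    using n by (simp add: gamma_nodes_iff)
  have "f (A 1) \<noteq> C j" for j
  proof
    assume eq: "f (A 1) = C j"
    then have j: "j \<in> {1..n}"
      using graph_autsD(3)[OF f A1] by (simp add: gamma_nodes_iff)
    then obtain u where u: "u \<in> gamma_nodes n" "f u = D j"
      using graph_auts_surj[OF f, of "D j"] by (auto simp: gamma_nodes_iff)
    then obtain l where "u = D l"
      using gamma_aut_D_iff[OF n f u(1)] by auto
    moreover have "{f (A 1), f u} \<in> gamma_edges n"
      unfolding eq u(2) using j by (simp add: gamma_edges_iff)
    ultimately show False
      using graph_autsD(4)[OF f A1 u(1)] by (simp add: gamma_edges_iff)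
  qed
  moreover have "f (A 1) \<notin> range D"
    using gamma_aut_D_iff[OF n f A1] by auto
  ultimately obtain j where "f (A 1) = A j \<or> f (A 1) = B j"
    by (cases "f (A 1)") auto
  moreover from this have "j \<in> {1..n}"
    using graph_autsD(3)[OF f A1] by (auto simp: gamma_nodes_iff)
  ultimately show thesis by (rule that)
qed

text \<open>Once a node \<open>A i\<close> or \<open>B i\<close> is fixed, so is its triangle: \<open>C i\<close> is the only neighbour of that
  node which is adjacent to a \<open>D\<close> node, and the third corner is the only common neighbour of the
  other two.\<close>

lemma gamma_aut_fixes_triangle:
  assumes n: "n \<ge> 4" and f: "f \<in> graph_auts (gamma_nodes n) (gamma_edges n)"
    and i: "i \<in> {1..n}" and fixed: "f (A i) = A i \<or> f (B i) = B i"
  shows "f (A i) = A i" "f (B i) = B i" "f (C i) = C i" "f (D i) = D i"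
proof -
  have V: "A i \<in> gamma_nodes n" "B i \<in> gamma_nodes n" "C i \<in> gamma_nodes n" "D i \<in> gamma_nodes n"
    using i by (simp_all add: gamma_nodes_iff)
  note edge = graph_autsD(4)[OF f]
  have AB: "{f (A i), f (B i)} \<in> gamma_edges n" and AC: "{f (A i), f (C i)} \<in> gamma_edges n"
    and BC: "{f (B i), f (C i)} \<in> gamma_edges n" and CD: "{f (C i), f (D i)} \<in> gamma_edges n"
    using i by (simp_all add: edge V gamma_edges_iff)
  obtain j where Dj: "f (D i) = D j"
    using gamma_aut_D_iff[OF n f V(4)] by auto
  have "f (C i) \<notin> range D"
    using gamma_aut_D_iff[OF n f V(3)] by auto
  then obtain c where c: "f (C i) = C c"
    using CD Dj by (cases "f (C i)") (auto simp: gamma_edges_iff)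
  then show C: "f (C i) = C i"
    using AC BC fixed by (auto simp: gamma_edges_iff)
  then show "f (D i) = D i"
    using CD Dj by (simp add: gamma_edges_iff)
  have no_D: "f (A i) \<notin> range D" "f (B i) \<notin> range D"
    using gamma_aut_D_iff[OF n f V(1)] gamma_aut_D_iff[OF n f V(2)] by auto
  have "f (B i) = B i" if "f (A i) = A i"
    using AB BC no_D(2) gamma_edges_iff(3)[of i i n] unfolding that C
    by (cases "f (B i)") (auto simp: gamma_edges_iff(1-3,6,7))
  moreover have "f (A i) = A i" if "f (B i) = B i"
    using AB AC no_D(1) gamma_edges_iff(3)[of i i n] unfolding that C
    by (cases "f (A i)") (auto simp: gamma_edges_iff(1-3,6,7))
  ultimately show "f (A i) = A i" "f (B i) = B i"
    using fixed by blast+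
qed

lemma gamma_aut_fixing_A1:
  assumes n: "n \<ge> 4" and f: "f \<in> graph_auts (gamma_nodes n) (gamma_edges n)"
    and A1: "f (A 1) = A 1" and v: "v \<in> gamma_nodes n"
  shows "f v = v"
proof -
  note tri = gamma_aut_fixes_triangle[OF n f]
  have A: "f (A i) = A i" if "1 \<le> i" "i \<le> n" for i
    using that
  proof (induction i rule: nat_induct_at_least)
    case (Suc i)
    then have i: "i \<in> {1..n}" "Suc i \<in> {1..n}" and Ai: "f (A i) = A i" by auto
    have V: "A i \<in> gamma_nodes n" "B i \<in> gamma_nodes n" "C i \<in> gamma_nodes n"
      "B (Suc i) \<in> gamma_nodes n"
      using i by (simp_all add: gamma_nodes_iff)
    have "f (B i) = B i" "f (C i) = C i"
      using tri[OF i(1)] Ai by blast+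
    then have ne: "f (B (Suc i)) \<noteq> B i" "f (B (Suc i)) \<noteq> C i"
      using graph_autsD(5)[OF f V(4,2)] graph_autsD(5)[OF f V(4,3)] by auto
    have "{A i, f (B (Suc i))} \<in> gamma_edges n"
      using graph_autsD(4)[OF f V(1,4)] i Ai by (simp add: gamma_edges_iff)
    \<comment> \<open>The neighbours of \<open>A i\<close> are \<open>B i\<close>, \<open>C i\<close> and \<open>B (i + 1)\<close>.\<close>
    then have "f (B (Suc i)) = B (Suc i)"
      using ne i by (cases "f (B (Suc i))") (auto simp: gamma_edges_iff)
    then show ?case
      using tri(1)[OF i(2)] by blast
  qed (use A1 in simp)
  have "f (A i) = A i" "f (B i) = B i" "f (C i) = C i" "f (D i) = D i" if i: "i \<in> {1..n}" for i
  proof -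
    have "f (A i) = A i"
      using A i by simp
    then show "f (A i) = A i" "f (B i) = B i" "f (C i) = C i" "f (D i) = D i"
      using tri[OF i] by blast+
  qed
  then show ?thesis
    using v by (cases v) (simp_all add: gamma_nodes_iff)
qed

section \<open>The automorphism group\<close>

theorem theorem5p2:
  fixes n :: nat
  assumes "n \<ge> 4"
  shows "graph_aut_group (gamma_nodes n) (gamma_edges n) \<cong> dihedral_group n"
proof -
  let ?V = "gamma_nodes n" and ?E = "gamma_edges n"
  let ?G = "graph_aut_group ?V ?E" and ?H = "dihedral_group n"
  have n: "n > 0" using assms by simp
  interpret G: group ?G by (rule group_graph_aut_group)
  interpret H: group ?H by (rule group_dihedral_group[OF n])
  have carrier: "carrier ?G = graph_auts ?V ?E"
    by (simp add: graph_aut_group_def)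
  have "f \<in> dihedral_aut n ` carrier ?H" if f: "f \<in> carrier ?G" for f
  proof -
    obtain j where "f (A 1) = A j \<or> f (A 1) = B j" "j \<in> {1..n}"
      using gamma_aut_A1[OF assms] f unfolding carrier by blast
    then obtain x where x: "x \<in> carrier ?H" "dihedral_aut n x (A 1) = f (A 1)"
      by (rule dihedral_aut_transitive)
    let ?g = "dihedral_aut n x"
    have g: "?g \<in> carrier ?G"
      using dihedral_aut_in_auts[OF n x(1)] carrier by simp
    define h where "h = inv\<^bsub>?G\<^esub> ?g \<otimes>\<^bsub>?G\<^esub> f"
    have h: "h \<in> carrier ?G" and gh: "f = ?g \<otimes>\<^bsub>?G\<^esub> h"
      using f g unfolding h_def by (simp_all flip: G.m_assoc)
    have comp: "f v = ?g (h v)" if "v \<in> ?V" for v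
      using arg_cong[OF gh, of "\<lambda>f. f v"] that g h
      by (simp add: carrier graph_auts_def graph_aut_group_def BijGroup_def compose_eq)
    have "A 1 \<in> ?V"
      using n by (simp add: gamma_nodes_iff)
    moreover from this have "?g (h (A 1)) = ?g (A 1)"
      using comp x by simp
    ultimately have "h (A 1) = A 1"
      using graph_autsD(3)[of h] graph_autsD(5)[of ?g] g h unfolding carrier by blast
    then have "h v = v" if "v \<in> ?V" for v
      using gamma_aut_fixing_A1[OF assms] h that unfolding carrier by blast
    then have "f = ?g"
      using graph_autsD(2)[of f] graph_autsD(2)[of ?g] f g comp
      unfolding carrier by (intro extensionalityI[of f ?V ?g]) auto
    then show ?thesis
      using x by blast
  qed
  moreover have "dihedral_aut n ` carrier ?H \<subseteq> carrier ?G"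
    using dihedral_aut_in_auts[OF n] carrier by blast
  ultimately have "bij_betw (dihedral_aut n) (carrier ?H) (carrier ?G)"
    using inj_on_dihedral_aut[OF n] unfolding bij_betw_def by blast
  then have "dihedral_aut n \<in> iso ?H ?G"
    using dihedral_aut_hom[OF n] by (simp add: iso_def)
  then have "?H \<cong> ?G"
    unfolding is_iso_def by blast
  then show ?thesis
    by (rule H.iso_sym)
qed

end
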